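(* Let $G$ and $H$ be finite simple connected graphs. If the strong product $G\boxtimes H$ is CDDR, then both $G$ and $H$ are CDDR graphs.
   Context: All graphs are finite, simple and connected. $\Gamma_i(u)$ is the set of vertices at distance exactly $i$ from $u$. A graph $G$ is CDDR (commutative distance degree-regular) if $|\Gamma_i(u)\cap\Gamma_j(v)|=|\Gamma_i(v)\cap\Gamma_j(u)|$ for all vertices $u,v$ and all $1\le i,j\le\operatorname{diam}(G)$. The strong product $G\boxtimes H$ has vertex set $V(G)\times V(H)$, and $(g_1,h_1)\sim(g_2,h_2)$ iff ($g_1\sim g_2$ and $h_1=h_2$) or ($g_1=g_2$ and $h_1\sim h_2$) or ($g_1\sim g_2$ and $h_1\sim h_2$). *)

theory Defs
  imports "Graph_Theory.Graph_Theory"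
begin

text \<open>
  A finite simple graph is a \<^locale>\<open>pair_graph\<close>: a finite, loop-free, symmetric digraph
  whose arcs are pairs of vertices. An edge is thus represented by its two orientations.
  \<^const>\<open>Digraph_Component.connected\<close> includes non-emptiness of the vertex set.
\<close>

text \<open>Only meaningful if some walk from \<open>u\<close> to \<open>v\<close> exists, e.g. in a connected graph.\<close>

definition graph_dist :: "'a pair_pre_digraph \<Rightarrow> 'a \<Rightarrow> 'a \<Rightarrow> nat" where
  "graph_dist G u v = (LEAST n. \<exists>p. pre_digraph.awalk (with_proj G) u p v \<and> length p = n)"

definition dist_sphere :: "'a pair_pre_digraph \<Rightarrow> nat \<Rightarrow> 'a \<Rightarrow> 'a set" where
  "dist_sphere G i u = {v \<in> pverts G. graph_dist G u v = i}"

definition graph_diam :: "'a pair_pre_digraph \<Rightarrow> nat" where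
  "graph_diam G = Max {graph_dist G u v | u v. u \<in> pverts G \<and> v \<in> pverts G}"

text \<open>
  Commutative distance degree-regularity. Being a finite simple connected graph is not part of
  the predicate and has to be assumed separately.
\<close>

definition CDDR :: "'a pair_pre_digraph \<Rightarrow> bool" where
  "CDDR G \<longleftrightarrow> (\<forall>u \<in> pverts G. \<forall>v \<in> pverts G.
     \<forall>i \<in> {1..graph_diam G}. \<forall>j \<in> {1..graph_diam G}.
       card (dist_sphere G i u \<inter> dist_sphere G j v) = card (dist_sphere G i v \<inter> dist_sphere G j u))"

definition strong_product ::
    "'a pair_pre_digraph \<Rightarrow> 'b pair_pre_digraph \<Rightarrow> ('a \<times> 'b) pair_pre_digraph"
    (infixl \<open>\<boxtimes>\<close> 70) where
  "G \<boxtimes> H = \<lparr> pverts = pverts G \<times> pverts H,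
     parcs = {((g1, h1), (g2, h2)) | g1 h1 g2 h2.
       g1 \<in> pverts G \<and> g2 \<in> pverts G \<and> h1 \<in> pverts H \<and> h2 \<in> pverts H \<and>
       ((g1, g2) \<in> parcs G \<and> h1 = h2 \<or>
        g1 = g2 \<and> (h1, h2) \<in> parcs H \<or>
        (g1, g2) \<in> parcs G \<and> (h1, h2) \<in> parcs H)} \<rparr>"

text \<open>The distance is the library's shortest-path cost for unit arc weights.\<close>

lemma graph_dist_eq_mu:
  assumes wf: "wf_digraph (with_proj G)" and r: "u \<rightarrow>\<^sup>*\<^bsub>with_proj G\<^esub> v"
  shows "wf_digraph.\<mu> (with_proj G) (\<lambda>_. 1) u v = ereal (real (graph_dist G u v))"
proof -
  interpret W: wf_digraph "with_proj G" by (rule wf)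
  have cost: "W.awalk_cost (\<lambda>_. 1) p = real (length p)" for p :: "('a \<times> 'a) awalk"
    by (induction p) (auto simp: W.awalk_cost_def)
  let ?P = "\<lambda>n. \<exists>p. W.awalk u p v \<and> length p = n"
  have "\<exists>n. ?P n" using r by (auto simp: W.reachable_awalk)
  then have ex: "?P (graph_dist G u v)" unfolding graph_dist_def by (rule LeastI_ex)
  have le: "graph_dist G u v \<le> length p" if "W.awalk u p v" for p
    unfolding graph_dist_def using that by (auto intro: Least_le)
  show ?thesis
  proof (rule antisym)
    show "W.\<mu> (\<lambda>_. 1) u v \<le> ereal (real (graph_dist G u v))"
      using ex W.min_cost_le_walk_cost[of u _ v "\<lambda>_. 1"] by (metis cost)
    show "ereal (real (graph_dist G u v)) \<le> W.\<mu> (\<lambda>_. 1) u v"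
      unfolding W.\<mu>_def by (rule INF_greatest) (auto simp: cost intro: le)
  qed
qed

lemma pair_graph_strong_product:
  assumes "pair_graph G" "pair_graph H"
  shows "pair_graph (G \<boxtimes> H)"
proof -
  interpret G: pair_graph G by fact
  interpret H: pair_graph H by fact
  have fin: "finite (pverts (G \<boxtimes> H))"
    by (simp add: strong_product_def)
  have "parcs (G \<boxtimes> H) \<subseteq> pverts (G \<boxtimes> H) \<times> pverts (G \<boxtimes> H)"
    by (auto simp: strong_product_def)
  then have fina: "finite (parcs (G \<boxtimes> H))"
    using fin by (meson finite_SigmaI finite_subset)
  have sG: "(b, a) \<in> parcs G" if "(a, b) \<in> parcs G" for a b
    using that G.sym_arcs by (auto simp: symmetric_def dest: symD)
  have sH: "(b, a) \<in> parcs H" if "(a, b) \<in> parcs H" for a b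
    using that H.sym_arcs by (auto simp: symmetric_def dest: symD)
  show ?thesis
  proof
    show "symmetric (with_proj (G \<boxtimes> H))"
      by (auto simp: symmetric_def strong_product_def sym_def intro: sG sH)
  qed (use fin fina in \<open>auto simp: strong_product_def dest: G.no_loops' H.no_loops'\<close>)
qed

end

theory Submission
  imports Defs
begin

text \<open>
  The idea is to replace spheres by balls. In a finite connected graph, commutative distance
  degree-regularity is equivalent to the symmetry, for all radii \<open>i\<close> and \<open>j\<close>, of the number of
  vertices within distance \<open>i\<close> of \<open>u\<close> and within distance \<open>j\<close> of \<open>v\<close>: sphere counts and ball counts
  determine each other by summation and differencing (\<open>CDDR_iff_ball_counts\<close>). Adjacency-or-equality
  in a strong product holds exactly when it holds in both coordinates, hence distances there are
  the maximum of the distances in the factors and a ball is the product of balls of the same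
  radius. Intersections of balls are then products as well, so that ball counts are multiplicative.

  Now compare the product vertices \<open>(u, h)\<close> and \<open>(v, h)\<close> with the same second coordinate. The count
  of \<open>H\<close> that occurs is that of two balls about the same vertex \<open>h\<close>. It is unaffected by exchanging
  the two product vertices, and it is positive because \<open>h\<close> lies in both balls. Cancelling it leaves
  the symmetry of the counts of \<open>G\<close>; the argument for \<open>H\<close> is the same with the coordinates exchanged.
\<close>

section \<open>Distances as powers of the reflexive adjacency relation\<close>

text \<open>
  With the loops added, walks of length exactly \<open>n\<close> stand for walks of length at most \<open>n\<close>, and the
  three clauses of strong adjacency collapse into one conjunction.
\<close>

definition step_rel :: "'a pair_pre_digraph \<Rightarrow> 'a rel" where
  "step_rel G = Id_on (pverts G) \<union> parcs G"

lemma awalk_imp_step_rel_power: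
  assumes "pair_graph G" "pre_digraph.awalk (with_proj G) u p v" "length p \<le> n"
  shows "(u, v) \<in> step_rel G ^^ n"
proof -
  interpret G: pair_graph G by fact
  show ?thesis using assms(2,3)
  proof (induction n arbitrary: u p)
    case 0
    then show ?case by (auto simp: G.awalk_Nil_iff)
  next
    case (Suc n)
    show ?case
    proof (cases p)
      case Nil
      then have "v = u" "u \<in> pverts G" using Suc.prems by (auto simp: G.awalk_Nil_iff)
      moreover have "(u, v) \<in> step_rel G ^^ n" using Suc Nil by auto
      ultimately show ?thesis
        by (intro relpow_Suc_I2[of u u]) (auto simp: step_rel_def)
    next
      case (Cons e es)
      then have "e \<in> parcs G" "u = fst e" "G.awalk (snd e) es v"
        using Suc.prems by (auto simp: G.awalk_Cons_iff)
      then show ?thesis using Suc Cons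
        by (intro relpow_Suc_I2[of u "snd e"]) (auto simp: step_rel_def)
    qed
  qed
qed

lemma step_rel_power_imp_awalk:
  assumes "pair_graph G" "(u, v) \<in> step_rel G ^^ n" "v \<in> pverts G"
  shows "\<exists>p. pre_digraph.awalk (with_proj G) u p v \<and> length p \<le> n"
proof -
  interpret G: pair_graph G by fact
  show ?thesis using assms(2)
  proof (induction n arbitrary: u)
    case 0
    then show ?case using assms(3) by (auto simp: G.awalk_Nil_iff)
  next
    case (Suc n)
    then obtain w where w: "(u, w) \<in> step_rel G" "(w, v) \<in> step_rel G ^^ n"
      by (meson relpow_Suc_D2)
    then obtain p where p: "G.awalk w p v" "length p \<le> n" using Suc.IH by blast
    from w(1) consider "u = w" | "(u, w) \<in> parcs G" by (auto simp: step_rel_def)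
    then show ?case
    proof cases
      case 1
      then show ?thesis using p le_SucI by blast
    next
      case 2
      then have "G.awalk u ((u, w) # p) v" using p by (simp add: G.awalk_Cons_iff)
      then show ?thesis using p by (metis Suc_le_mono length_Cons)
    qed
  qed
qed

text \<open>
  Some walk has to exist, since the distance is an arbitrary number otherwise.
\<close>

lemma graph_dist_le_iff:
  assumes G: "pair_graph G" and v: "v \<in> pverts G"
    and ex: "\<exists>m. (u, v) \<in> step_rel G ^^ m"
  shows "graph_dist G u v \<le> n \<longleftrightarrow> (u, v) \<in> step_rel G ^^ n"
proof
  let ?P = "\<lambda>n. \<exists>p. pre_digraph.awalk (with_proj G) u p v \<and> length p = n"
  have "\<exists>n. ?P n" using step_rel_power_imp_awalk[OF G _ v] ex by blast
  then have "?P (graph_dist G u v)" unfolding graph_dist_def by (rule LeastI_ex)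
  moreover assume "graph_dist G u v \<le> n"
  ultimately show "(u, v) \<in> step_rel G ^^ n"
    using awalk_imp_step_rel_power[OF G] by metis
next
  assume "(u, v) \<in> step_rel G ^^ n"
  then obtain p where p: "pre_digraph.awalk (with_proj G) u p v" "length p \<le> n"
    using step_rel_power_imp_awalk[OF G _ v] by blast
  then have "graph_dist G u v \<le> length p"
    unfolding graph_dist_def by (auto intro: Least_le)
  then show "graph_dist G u v \<le> n" using p(2) by simp
qed

lemma connected_step_rel_power:
  assumes G: "pair_graph G" and "Digraph_Component.connected (with_proj G)"
    and "u \<in> pverts G" "v \<in> pverts G"
  shows "\<exists>m. (u, v) \<in> step_rel G ^^ m"
proof -
  interpret G: pair_graph G by fact
  have "u \<rightarrow>\<^sup>*\<^bsub>with_proj G\<^esub> v"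
    using G.symmetric_connected_imp_strongly_connected[OF G.sym_arcs assms(2)] assms(3,4)
    by (auto simp: strongly_connected_def)
  then obtain p where "G.awalk u p v" by (auto simp: G.reachable_awalk)
  then show ?thesis using awalk_imp_step_rel_power[OF G _ order_refl] by blast
qed

lemma sym_step_rel:
  assumes "pair_graph G"
  shows "sym (step_rel G)"
proof -
  interpret G: pair_graph G by fact
  show ?thesis using G.sym_arcs by (auto simp: step_rel_def symmetric_def sym_def)
qed

lemma sym_relpow:
  assumes "sym R"
  shows "sym (R ^^ n)"
proof (induction n)
  case (Suc n)
  have "(R ^^ Suc n)\<inverse> = R\<inverse> O (R ^^ n)\<inverse>" by (simp add: converse_relcomp)
  also have "\<dots> = R ^^ Suc n"
    using assms Suc by (simp add: sym_conv_converse_eq relpow_commute)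
  finally show ?case by (simp only: sym_conv_converse_eq)
qed (simp add: sym_Id)

section \<open>Sphere counts and ball counts\<close>

definition ball_count :: "'a pair_pre_digraph \<Rightarrow> nat \<Rightarrow> nat \<Rightarrow> 'a \<Rightarrow> 'a \<Rightarrow> nat" where
  "ball_count G i j u v = card {w \<in> pverts G. graph_dist G u w \<le> i \<and> graph_dist G v w \<le> j}"

lemma card_eq_levels_iff_card_le_levels:
  fixes f :: "'a \<Rightarrow> nat" and g :: "'b \<Rightarrow> nat"
  assumes "finite A" "finite B"
  shows "(\<forall>i. card {x \<in> A. f x = i} = card {x \<in> B. g x = i}) \<longleftrightarrow>
         (\<forall>i. card {x \<in> A. f x \<le> i} = card {x \<in> B. g x \<le> i})"
    (is "?eq \<longleftrightarrow> ?le")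
proof -
  have split: "card {x \<in> C. h x \<le> Suc i} = card {x \<in> C. h x \<le> i} + card {x \<in> C. h x = Suc i}"
    if "finite C" for C :: "'c set" and h :: "'c \<Rightarrow> nat" and i
    using that by (subst card_Un_disjoint[symmetric]) (auto intro!: arg_cong[of _ _ card])
  show ?thesis
  proof
    assume eq: ?eq
    show ?le
    proof
      fix i
      show "card {x \<in> A. f x \<le> i} = card {x \<in> B. g x \<le> i}"
      proof (induction i)
        case 0
        then show ?case using eq by simp
      next
        case (Suc i)
        then show ?case using eq by (simp only: split[OF assms(1)] split[OF assms(2)])
      qed
    qed
  next
    assume le: ?le
    show ?eq
    proof
      fix i
      show "card {x \<in> A. f x = i} = card {x \<in> B. g x = i}"
      proof (cases i)
        case 0
        then show ?thesis using le[rule_format, of 0] by simp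
      next
        case (Suc k)
        then show ?thesis
          using le[rule_format, of k] le[rule_format, of "Suc k"]
          by (simp only: split[OF assms(1)] split[OF assms(2)])
      qed
    qed
  qed
qed

text \<open>
  The equivalence for one function, applied to each of the two coordinates in turn while the other
  one cuts out the underlying finite set.
\<close>

lemma card_eq_levels2_iff_card_le_levels2:
  fixes f f' :: "'a \<Rightarrow> nat" and g g' :: "'b \<Rightarrow> nat"
  assumes "finite A" "finite B"
  shows "(\<forall>i j. card {x \<in> A. f x = i \<and> f' x = j} = card {x \<in> B. g x = i \<and> g' x = j}) \<longleftrightarrow>
         (\<forall>i j. card {x \<in> A. f x \<le> i \<and> f' x \<le> j} = card {x \<in> B. g x \<le> i \<and> g' x \<le> j})"
proof -
  have first: "(\<forall>i. card {x \<in> A. P x \<and> f' x = i} = card {x \<in> B. Q x \<and> g' x = i}) \<longleftrightarrow>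
               (\<forall>i. card {x \<in> A. P x \<and> f' x \<le> i} = card {x \<in> B. Q x \<and> g' x \<le> i})" for P Q
    using card_eq_levels_iff_card_le_levels[of "{x \<in> A. P x}" "{x \<in> B. Q x}" f' g'] assms
    by simp
  have second: "(\<forall>i. card {x \<in> A. f x = i \<and> P x} = card {x \<in> B. g x = i \<and> Q x}) \<longleftrightarrow>
                (\<forall>i. card {x \<in> A. f x \<le> i \<and> P x} = card {x \<in> B. g x \<le> i \<and> Q x})" for P Q
    using card_eq_levels_iff_card_le_levels[of "{x \<in> A. P x}" "{x \<in> B. Q x}" f g] assms
    by (simp add: conj_ac)
  have "(\<forall>i j. card {x \<in> A. f x = i \<and> f' x = j} = card {x \<in> B. g x = i \<and> g' x = j}) \<longleftrightarrow>
        (\<forall>i j. card {x \<in> A. f x = i \<and> f' x \<le> j} = card {x \<in> B. g x = i \<and> g' x \<le> j})"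
    by (rule all_cong1) (rule first)
  also have "\<dots> \<longleftrightarrow>
        (\<forall>j i. card {x \<in> A. f x = i \<and> f' x \<le> j} = card {x \<in> B. g x = i \<and> g' x \<le> j})"
    by (rule all_comm)
  also have "\<dots> \<longleftrightarrow>
        (\<forall>j i. card {x \<in> A. f x \<le> i \<and> f' x \<le> j} = card {x \<in> B. g x \<le> i \<and> g' x \<le> j})"
    by (rule all_cong1) (rule second)
  also have "\<dots> \<longleftrightarrow>
        (\<forall>i j. card {x \<in> A. f x \<le> i \<and> f' x \<le> j} = card {x \<in> B. g x \<le> i \<and> g' x \<le> j})"
    by (rule all_comm)
  finally show ?thesis .
qed

text \<open>
  Balls involve all radii, whereas \<^const>\<open>CDDR\<close> speaks of the radii from \<open>1\<close> to the diameter. The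
  other sphere counts are symmetric in every connected graph: a sphere of radius \<open>0\<close> is a single
  vertex, for which the condition is the symmetry of the distance, and spheres beyond the diameter
  are empty.
\<close>

lemma CDDR_iff_ball_counts:
  assumes G: "pair_graph G" and con: "Digraph_Component.connected (with_proj G)"
  shows "CDDR G \<longleftrightarrow>
    (\<forall>u \<in> pverts G. \<forall>v \<in> pverts G. \<forall>i j. ball_count G i j u v = ball_count G i j v u)"
proof -
  interpret G: pair_graph G by fact
  let ?d = "graph_dist G"
  have le_iff: "?d u v \<le> n \<longleftrightarrow> (u, v) \<in> step_rel G ^^ n"
    if "u \<in> pverts G" "v \<in> pverts G" for u v n
    using graph_dist_le_iff[OF G that(2) connected_step_rel_power[OF G con that]] .
  have d_sym: "?d u v = ?d v u" if "u \<in> pverts G" "v \<in> pverts G" for u v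
    using le_iff[OF that] le_iff[OF that(2,1)] sym_relpow[OF sym_step_rel[OF G]]
    by (meson order_antisym order_refl symD)
  have d_0: "?d u v = 0 \<longleftrightarrow> u = v" if "u \<in> pverts G" "v \<in> pverts G" for u v
    using le_iff[OF that, of 0] by simp
  have d_diam: "?d u v \<le> graph_diam G" if "u \<in> pverts G" "v \<in> pverts G" for u v
  proof -
    have "{?d u v | u v. u \<in> pverts G \<and> v \<in> pverts G}
        = (\<lambda>(u, v). ?d u v) ` (pverts G \<times> pverts G)" by auto
    then have "finite {?d u v | u v. u \<in> pverts G \<and> v \<in> pverts G}" by simp
    then show ?thesis unfolding graph_diam_def using that by (auto intro!: Max_ge)
  qed
  let ?N = "\<lambda>u v i j. card {w \<in> pverts G. ?d u w = i \<and> ?d v w = j}"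
  have sphere: "card (dist_sphere G i u \<inter> dist_sphere G j v) = ?N u v i j" for i j u v
    by (rule arg_cong[of _ _ card]) (auto simp: dist_sphere_def)
  have zero: "?N u v 0 j = ?N v u 0 j" "?N u v j 0 = ?N v u j 0"
    if uv: "u \<in> pverts G" "v \<in> pverts G" for u v j
  proof -
    have single: "{w \<in> pverts G. ?d a w = 0 \<and> ?d b w = j} = (if ?d a b = j then {a} else {})"
      "{w \<in> pverts G. ?d b w = j \<and> ?d a w = 0} = (if ?d a b = j then {a} else {})"
      if "a \<in> pverts G" "b \<in> pverts G" for a b
      using that d_0 d_sym by (auto split: if_splits)
    show "?N u v 0 j = ?N v u 0 j" "?N u v j 0 = ?N v u j 0"
      unfolding single[OF uv] single[OF uv(2,1)] using d_sym[OF uv] by simp_all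
  qed
  have large: "?N u v i j = 0"
    if "u \<in> pverts G" "v \<in> pverts G" "i > graph_diam G \<or> j > graph_diam G" for u v i j
    using that d_diam by fastforce
  have all_radii: "(\<forall>i \<in> {1..graph_diam G}. \<forall>j \<in> {1..graph_diam G}. ?N u v i j = ?N v u i j)
      \<longleftrightarrow> (\<forall>i j. ?N u v i j = ?N v u i j)" (is "?L \<longleftrightarrow> ?R")
    if uv: "u \<in> pverts G" "v \<in> pverts G" for u v
  proof
    assume L: ?L
    show ?R
    proof (intro allI)
      fix i j
      consider "i = 0" | "j = 0" | "i > graph_diam G \<or> j > graph_diam G"
        | "i \<in> {1..graph_diam G}" "j \<in> {1..graph_diam G}"
        by fastforce
      then show "?N u v i j = ?N v u i j"
      proof cases
        case 3
        then show ?thesis using large[OF uv 3] large[OF uv(2,1) 3] by argo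
      qed (use L zero[OF uv] in auto)
    qed
  qed blast
  have "CDDR G \<longleftrightarrow> (\<forall>u \<in> pverts G. \<forall>v \<in> pverts G. \<forall>i j. ?N u v i j = ?N v u i j)"
    unfolding CDDR_def sphere using all_radii by (intro ball_cong refl) blast
  also have "\<dots> \<longleftrightarrow>
      (\<forall>u \<in> pverts G. \<forall>v \<in> pverts G. \<forall>i j. ball_count G i j u v = ball_count G i j v u)"
    unfolding ball_count_def
    by (intro ball_cong refl card_eq_levels2_iff_card_le_levels2) simp_all
  finally show ?thesis .
qed

section \<open>Balls in strong products\<close>

lemma pverts_strong_product [simp]: "pverts (G \<boxtimes> H) = pverts G \<times> pverts H"
  by (simp add: strong_product_def)

lemma step_rel_strong_product:
  assumes "pair_graph G" "pair_graph H"
  shows "((g, h), (g', h')) \<in> step_rel (G \<boxtimes> H) \<longleftrightarrow>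
    (g, g') \<in> step_rel G \<and> (h, h') \<in> step_rel H"
proof -
  interpret G: pair_graph G by fact
  interpret H: pair_graph H by fact
  show ?thesis
    by (auto simp: step_rel_def strong_product_def dest: G.in_arcsD1 G.in_arcsD2 H.in_arcsD1 H.in_arcsD2)
qed

lemma step_rel_power_strong_product:
  assumes "pair_graph G" "pair_graph H"
  shows "((g, h), (g', h')) \<in> step_rel (G \<boxtimes> H) ^^ n \<longleftrightarrow>
    (g, g') \<in> step_rel G ^^ n \<and> (h, h') \<in> step_rel H ^^ n"
proof (induction n arbitrary: g' h')
  case (Suc n)
  then show ?case by (force simp: relcomp_unfold step_rel_strong_product[OF assms])
qed auto

lemma graph_dist_strong_product_le_iff:
  assumes G: "pair_graph G" "Digraph_Component.connected (with_proj G)"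
    and H: "pair_graph H" "Digraph_Component.connected (with_proj H)"
    and g: "g \<in> pverts G" "g' \<in> pverts G" and h: "h \<in> pverts H" "h' \<in> pverts H"
  shows "graph_dist (G \<boxtimes> H) (g, h) (g', h') \<le> n \<longleftrightarrow>
    graph_dist G g g' \<le> n \<and> graph_dist H h h' \<le> n"
proof -
  have G_iff: "graph_dist G g g' \<le> m \<longleftrightarrow> (g, g') \<in> step_rel G ^^ m" for m
    using graph_dist_le_iff[OF G(1) g(2) connected_step_rel_power[OF G g]] .
  have H_iff: "graph_dist H h h' \<le> m \<longleftrightarrow> (h, h') \<in> step_rel H ^^ m" for m
    using graph_dist_le_iff[OF H(1) h(2) connected_step_rel_power[OF H h]] .
  let ?m = "max (graph_dist G g g') (graph_dist H h h')"
  have "(g, g') \<in> step_rel G ^^ ?m" "(h, h') \<in> step_rel H ^^ ?m"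
    using G_iff[of ?m] H_iff[of ?m] by auto
  then have "((g, h), (g', h')) \<in> step_rel (G \<boxtimes> H) ^^ ?m"
    by (simp add: step_rel_power_strong_product[OF G(1) H(1)])
  then show ?thesis
    using graph_dist_le_iff[OF pair_graph_strong_product[OF G(1) H(1)], of "(g', h')" "(g, h)" n] g h
      G_iff H_iff by (auto simp: step_rel_power_strong_product[OF G(1) H(1)])
qed

lemma connected_strong_product:
  assumes G: "pair_graph G" "Digraph_Component.connected (with_proj G)"
    and H: "pair_graph H" "Digraph_Component.connected (with_proj H)"
  shows "Digraph_Component.connected (with_proj (G \<boxtimes> H))"
proof -
  interpret G: pair_graph G by fact
  interpret H: pair_graph H by fact
  interpret GH: pair_graph "G \<boxtimes> H" by (rule pair_graph_strong_product[OF G(1) H(1)])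
  have reach: "x \<rightarrow>\<^sup>*\<^bsub>with_proj (G \<boxtimes> H)\<^esub> y"
    if xy: "x \<in> pverts (G \<boxtimes> H)" "y \<in> pverts (G \<boxtimes> H)" for x y
  proof -
    obtain g h g' h' where eq: "x = (g, h)" "y = (g', h')" by (metis surj_pair)
    then have g: "g \<in> pverts G" "g' \<in> pverts G" and h: "h \<in> pverts H" "h' \<in> pverts H"
      using xy by auto
    let ?m = "max (graph_dist G g g') (graph_dist H h h')"
    have "(g, g') \<in> step_rel G ^^ ?m" "(h, h') \<in> step_rel H ^^ ?m"
      using graph_dist_le_iff[OF G(1) g(2) connected_step_rel_power[OF G g], of ?m]
        graph_dist_le_iff[OF H(1) h(2) connected_step_rel_power[OF H h], of ?m] by auto
    then have "(x, y) \<in> step_rel (G \<boxtimes> H) ^^ ?m"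
      by (simp add: eq step_rel_power_strong_product[OF G(1) H(1)])
    then show ?thesis
      using step_rel_power_imp_awalk[OF pair_graph_strong_product[OF G(1) H(1)] _ xy(2)]
      unfolding GH.reachable_awalk by blast
  qed
  have "pverts G \<noteq> {}" "pverts H \<noteq> {}"
    using G(2) H(2) by (auto simp: connected_def strongly_connected_def)
  then show ?thesis
    using GH.reachable_mk_symmetricI[OF reach]
    by (auto simp: connected_def strongly_connected_def)
qed

lemma ball_count_strong_product:
  assumes G: "pair_graph G" "Digraph_Component.connected (with_proj G)"
    and H: "pair_graph H" "Digraph_Component.connected (with_proj H)"
    and "g \<in> pverts G" "g' \<in> pverts G" "h \<in> pverts H" "h' \<in> pverts H"
  shows "ball_count (G \<boxtimes> H) i j (g, h) (g', h') = ball_count G i j g g' * ball_count H i j h h'"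
proof -
  have "{w \<in> pverts (G \<boxtimes> H). graph_dist (G \<boxtimes> H) (g, h) w \<le> i \<and> graph_dist (G \<boxtimes> H) (g', h') w \<le> j}
    = {w \<in> pverts G. graph_dist G g w \<le> i \<and> graph_dist G g' w \<le> j} \<times>
      {w \<in> pverts H. graph_dist H h w \<le> i \<and> graph_dist H h' w \<le> j}"
    using assms by (auto simp: graph_dist_strong_product_le_iff[OF G H])
  then show ?thesis by (simp add: ball_count_def card_cartesian_product)
qed

lemma ball_count_refl_pos:
  assumes G: "pair_graph G" and u: "u \<in> pverts G"
  shows "ball_count G i j u u > 0"
proof -
  interpret G: pair_graph G by fact
  have "(u, u) \<in> step_rel G ^^ 0" by simp
  then have "graph_dist G u u \<le> 0" using graph_dist_le_iff[OF G u] by blast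
  then have "u \<in> {w \<in> pverts G. graph_dist G u w \<le> i \<and> graph_dist G u w \<le> j}"
    using u by simp
  then show ?thesis unfolding ball_count_def by (subst card_gt_0_iff) auto
qed

section \<open>Descent to the factors\<close>

theorem theorem3p9:
  fixes G :: "'a pair_pre_digraph" and H :: "'b pair_pre_digraph"
  assumes "pair_graph G" and "Digraph_Component.connected (with_proj G)"
    and "pair_graph H" and "Digraph_Component.connected (with_proj H)"
    and "CDDR (G \<boxtimes> H)"
  shows "CDDR G \<and> CDDR H"
proof -
  note G = assms(1,2) and H = assms(3,4)
  have sym: "ball_count G i j g g' * ball_count H i j h h' = ball_count G i j g' g * ball_count H i j h' h"
    if "g \<in> pverts G" "g' \<in> pverts G" "h \<in> pverts H" "h' \<in> pverts H" for g g' h h' i j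
    using that assms(5)
      CDDR_iff_ball_counts[OF pair_graph_strong_product[OF G(1) H(1)] connected_strong_product[OF G H]]
    by (simp add: ball_count_strong_product[OF G H, symmetric])
  obtain g h where g: "g \<in> pverts G" and h: "h \<in> pverts H"
    using G(2) H(2) by (fastforce simp: connected_def strongly_connected_def)
  have "CDDR G"
    unfolding CDDR_iff_ball_counts[OF G]
  proof (intro ballI allI)
    fix u v i j assume "u \<in> pverts G" "v \<in> pverts G"
    then show "ball_count G i j u v = ball_count G i j v u"
      using sym[of u v h h i j] ball_count_refl_pos[OF H(1) h, of i j] h by simp
  qed
  moreover have "CDDR H"
    unfolding CDDR_iff_ball_counts[OF H]
  proof (intro ballI allI)
    fix u v i j assume "u \<in> pverts H" "v \<in> pverts H"
    then show "ball_count H i j u v = ball_count H i j v u"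
      using sym[of g g u v i j] ball_count_refl_pos[OF G(1) g, of i j] g by simp
  qed
  ultimately show ?thesis ..
qed

end
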